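(* Under bilateral link formation with the smart adversary, the price of anarchy with respect to pairwise stability (and hence also with respect to pairwise Nash equilibrium) is $O\big(1+\frac{n}{\alpha}\big)$: there is an absolute constant $c>0$ such that for all integers $n\ge 3$, all $\alpha>0$ and every pairwise stable strategy profile $S$ for $n$ players and link cost $\alpha$, $$\frac{C(S)}{\mathrm{OPT}(n,\alpha)}\le c\Big(1+\frac n\alpha\Big).$$
   Context: Players are $V=\{1,\dots,n\}$ ($n\ge 3$), link cost is $\alpha>0$. A strategy profile is a matrix $S\in\{0,1\}^{n\times n}$ with $S_{vv}=0$; for $v\ne w$, $S_{vw}=1$ means that player $v$ requests the edge $\{v,w\}$. Bilateral link formation: the final graph is the simple undirected graph $G(S)=(V,E(S))$ with $E(S)=\{\{v,w\}: S_{vw}=1 \text{ and } S_{wv}=1\}$. Optima and equilibria are taken among essential profiles only ($S_{vw}=1\Rightarrow S_{wv}=1$), so an equilibrium is determined by its final graph. $S+(v,w)$, $S-(v,w)$ denote $S$ with the entry $S_{vw}$ set to $1$, respectively $0$. For a connected graph $G=(V,E)$, $e\in E$, $v\in V$, the relevance $\mathrm{rel}_G(e,v)$ is the number of vertices that, starting at $v$, can only be reached via $e$ (so it is $0$ iff $e$ is not a bridge). Let $\mathrm{sep}(e)=\sum_{v\in V}\mathrm{rel}_G(e,v)$, $\mathrm{sep}_{\max}=\max_{e\in E}\mathrm{sep}(e)$ and $E_{\max}=\{e\in E:\mathrm{sep}(e)=\mathrm{sep}_{\max}\}$. The smart adversary removes one edge chosen uniformly at random from $E_{\max}$; so the disconnection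 cost of $v$ is $I_v(G)=\frac{1}{|E_{\max}|}\sum_{e\in E_{\max}}\mathrm{rel}_G(e,v)$ if $G$ is connected and $I_v(G)=\infty$ otherwise. Individual cost: $C_v(S)=\alpha\sum_{w}S_{vw}+I_v(G(S))$. Social cost: $C(S)=\sum_{v}C_v(S)$ ($=2\alpha|E(S)|+\sum_v I_v(G(S))$ for essential $S$). $\mathrm{OPT}(n,\alpha)$ is the minimum social cost. $S$ is pairwise stable if (a) for all $\{v,w\}\in E(S)$: $C_v(S-(v,w))\ge C_v(S)$ and $C_w(S-(w,v))\ge C_w(S)$; and (b) for all $v\ne w$ with $\{v,w\}\notin E(S)$: if $C_v(S+(v,w)+(w,v))\le C_v(S)$ then $C_w(S+(v,w)+(w,v))>C_w(S)$. $S$ is a pairwise Nash equilibrium if (b) holds and no player $v$ can strictly decrease $C_v$ by changing her own row $S_v$ arbitrarily; every pairwise Nash equilibrium is pairwise stable. *)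

theory Defs
  imports "HOL-Library.Extended_Real"
begin

text \<open>The players are \<open>{1..n}\<close>. A 0/1 matrix is a Boolean function that is False outside
  \<open>{1..n} \<times> {1..n}\<close>; this makes the representation of an \<open>n \<times> n\<close> matrix unique.\<close>

definition profile :: "nat \<Rightarrow> (nat \<Rightarrow> nat \<Rightarrow> bool) \<Rightarrow> bool" where
  "profile n S \<longleftrightarrow> (\<forall>v w. S v w \<longrightarrow> v \<in> {1..n} \<and> w \<in> {1..n} \<and> v \<noteq> w)"

definition essential :: "nat \<Rightarrow> (nat \<Rightarrow> nat \<Rightarrow> bool) \<Rightarrow> bool" where
  "essential n S \<longleftrightarrow> profile n S \<and> (\<forall>v w. S v w \<longrightarrow> S w v)"

definition set_entry ::
  "(nat \<Rightarrow> nat \<Rightarrow> bool) \<Rightarrow> nat \<Rightarrow> nat \<Rightarrow> bool \<Rightarrow> nat \<Rightarrow> nat \<Rightarrow> bool" where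
  "set_entry S v w b = S(v := (S v)(w := b))"

definition final_edges :: "nat \<Rightarrow> (nat \<Rightarrow> nat \<Rightarrow> bool) \<Rightarrow> nat set set" where
  "final_edges n S = {{v, w} | v w. v \<in> {1..n} \<and> w \<in> {1..n} \<and> v \<noteq> w \<and> S v w \<and> S w v}"

definition walk_edges :: "'a list \<Rightarrow> 'a set set" where
  "walk_edges p = {{p ! i, p ! Suc i} | i. Suc i < length p}"

definition walk :: "'a set \<Rightarrow> 'a set set \<Rightarrow> 'a \<Rightarrow> 'a list \<Rightarrow> 'a \<Rightarrow> bool" where
  "walk V E v p w \<longleftrightarrow> p \<noteq> [] \<and> hd p = v \<and> last p = w \<and> set p \<subseteq> V \<and> walk_edges p \<subseteq> E"

definition connected_graph :: "'a set \<Rightarrow> 'a set set \<Rightarrow> bool" where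
  "connected_graph V E \<longleftrightarrow> (\<forall>v \<in> V. \<forall>w \<in> V. \<exists>p. walk V E v p w)"

text \<open>The notions from here to \<open>E_max\<close> are meant for connected graphs only: in a disconnected
  graph \<open>rel\<close> would also count the vertices that cannot be reached from \<open>v\<close> at all.\<close>

definition rel :: "'a set \<Rightarrow> 'a set set \<Rightarrow> 'a set \<Rightarrow> 'a \<Rightarrow> nat" where
  "rel V E e v = card {w \<in> V. \<forall>p. walk V E v p w \<longrightarrow> e \<in> walk_edges p}"

definition sep :: "'a set \<Rightarrow> 'a set set \<Rightarrow> 'a set \<Rightarrow> nat" where
  "sep V E e = (\<Sum>v \<in> V. rel V E e v)"

definition sep_max :: "'a set \<Rightarrow> 'a set set \<Rightarrow> nat" where
  "sep_max V E = Max (sep V E ` E)"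

definition E_max :: "'a set \<Rightarrow> 'a set set \<Rightarrow> 'a set set" where
  "E_max V E = {e \<in> E. sep V E e = sep_max V E}"

definition disconnection_cost :: "'a set \<Rightarrow> 'a set set \<Rightarrow> 'a \<Rightarrow> ereal" where
  "disconnection_cost V E v =
     (if connected_graph V E
      then ereal (1 / real (card (E_max V E)) * (\<Sum>e \<in> E_max V E. real (rel V E e v)))
      else \<infinity>)"

definition individual_cost :: "nat \<Rightarrow> real \<Rightarrow> (nat \<Rightarrow> nat \<Rightarrow> bool) \<Rightarrow> nat \<Rightarrow> ereal" where
  "individual_cost n \<alpha> S v =
     ereal (\<alpha> * (\<Sum>w \<in> {1..n}. of_bool (S v w))) +
     disconnection_cost {1..n} (final_edges n S) v"

definition social_cost :: "nat \<Rightarrow> real \<Rightarrow> (nat \<Rightarrow> nat \<Rightarrow> bool) \<Rightarrow> ereal" where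
  "social_cost n \<alpha> S = (\<Sum>v \<in> {1..n}. individual_cost n \<alpha> S v)"

definition OPT :: "nat \<Rightarrow> real \<Rightarrow> ereal" where
  "OPT n \<alpha> = Min (social_cost n \<alpha> ` {S. essential n S})"

text \<open>\<open>Min\<close> is meaningful only for finite nonempty sets.\<close>

lemma finite_essential: "finite {S. essential n S}"
proof (rule finite_subset)
  show "{S. essential n S} \<subseteq> (\<lambda>R v w. (v, w) \<in> R) ` Pow ({1..n} \<times> {1..n})"
  proof
    fix S assume "S \<in> {S. essential n S}"
    then have "{(v, w). S v w} \<in> Pow ({1..n} \<times> {1..n})"
      by (auto simp: essential_def profile_def)
    moreover have "S = (\<lambda>v w. (v, w) \<in> {(v, w). S v w})" by simp
    ultimately show "S \<in> (\<lambda>R v w. (v, w) \<in> R) ` Pow ({1..n} \<times> {1..n})" by blast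
  qed
qed simp

lemma essential_nonempty: "{S. essential n S} \<noteq> {}"
proof -
  have "essential n (\<lambda>_ _. False)" by (simp add: essential_def profile_def)
  then show ?thesis by blast
qed

text \<open>Disconnected profiles have infinite cost, so in the comparisons below
  \<open>\<infinity> \<le> \<infinity>\<close> holds and \<open>\<infinity> > \<infinity>\<close> fails.\<close>

definition no_mutual_addition :: "nat \<Rightarrow> real \<Rightarrow> (nat \<Rightarrow> nat \<Rightarrow> bool) \<Rightarrow> bool" where
  "no_mutual_addition n \<alpha> S \<longleftrightarrow>
     (\<forall>v \<in> {1..n}. \<forall>w \<in> {1..n}. v \<noteq> w \<and> {v, w} \<notin> final_edges n S \<longrightarrow>
        (let S' = set_entry (set_entry S v w True) w v True in
           individual_cost n \<alpha> S' v \<le> individual_cost n \<alpha> S v \<longrightarrow>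
           individual_cost n \<alpha> S' w > individual_cost n \<alpha> S w))"

definition pairwise_stable :: "nat \<Rightarrow> real \<Rightarrow> (nat \<Rightarrow> nat \<Rightarrow> bool) \<Rightarrow> bool" where
  "pairwise_stable n \<alpha> S \<longleftrightarrow>
     (\<forall>v w. {v, w} \<in> final_edges n S \<longrightarrow>
        individual_cost n \<alpha> (set_entry S v w False) v \<ge> individual_cost n \<alpha> S v \<and>
        individual_cost n \<alpha> (set_entry S w v False) w \<ge> individual_cost n \<alpha> S w) \<and>
     no_mutual_addition n \<alpha> S"

text \<open>A deviation \<open>r\<close> is an arbitrary row; the deviated profile need not be essential.\<close>

definition pairwise_nash :: "nat \<Rightarrow> real \<Rightarrow> (nat \<Rightarrow> nat \<Rightarrow> bool) \<Rightarrow> bool" where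
  "pairwise_nash n \<alpha> S \<longleftrightarrow>
     (\<forall>v \<in> {1..n}. \<forall>r. profile n (S(v := r)) \<longrightarrow>
        individual_cost n \<alpha> (S(v := r)) v \<ge> individual_cost n \<alpha> S v) \<and>
     no_mutual_addition n \<alpha> S"

end

theory Submission
  imports Defs
begin

text \<open>Choose a spanning forest \<open>F\<^sub>1\<close> of the graph of a pairwise stable profile and a spanning forest
  \<open>F\<^sub>2\<close> of what remains. The endpoints of any further edge are joined by two edge-disjoint paths
  avoiding that edge, so deleting it neither disconnects the graph nor changes any relevance, and
  saves its owners \<open>\<alpha>\<close>. Hence a pairwise stable graph has at most \<open>2n\<close> edges. As every disconnection
  cost is at most \<open>n\<close> and every vertex of a connected graph pays for at least one edge, the ratio
  is at most \<open>(4 \<alpha> n + n\<^sup>2) / (\<alpha> n) = 4 + n / \<alpha>\<close>.\<close>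

section \<open>Reachability along edges and its relation to walks\<close>

text \<open>Reachability is treated as the reflexive transitive closure of this symmetric relation,
  so that closure laws replace the manipulation of explicit walks.\<close>

definition adj :: "'a set set \<Rightarrow> ('a \<times> 'a) set" where
  "adj E = {(x, y). {x, y} \<in> E}"

lemma sym_adj_rtrancl: "sym ((adj E)\<^sup>*)"
  by (rule sym_rtrancl) (auto simp: sym_def adj_def insert_commute)

lemma adj_insert: "adj (insert {u, v} E) = adj E \<union> {(u, v), (v, u)}"
  by (auto simp: adj_def doubleton_eq_iff)

lemma adj_mono: "E \<subseteq> F \<Longrightarrow> adj E \<subseteq> adj F"
  by (auto simp: adj_def)

lemma rtrancl_adj_mono: "E \<subseteq> F \<Longrightarrow> (adj E)\<^sup>* \<subseteq> (adj F)\<^sup>*"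
  by (intro rtrancl_mono adj_mono)

text \<open>A step along the new edge can be replaced by a path in \<open>E\<close>; symmetry
  supplies the path for the opposite direction.\<close>

lemma rtrancl_adj_insert_redundant:
  assumes "(u, v) \<in> (adj E)\<^sup>*"
  shows "(adj (insert {u, v} E))\<^sup>* = (adj E)\<^sup>*"
proof (rule rtrancl_subset)
  show "adj E \<subseteq> adj (insert {u, v} E)" by (rule adj_mono) auto
  show "adj (insert {u, v} E) \<subseteq> (adj E)\<^sup>*"
    using assms symD[OF sym_adj_rtrancl assms] by (auto simp: adj_insert)
qed

lemma walk_edges_singleton [simp]: "walk_edges [x] = {}"
  by (simp add: walk_edges_def)

lemma walk_edges_Cons_Cons: "walk_edges (x # y # p) = insert {x, y} (walk_edges (y # p))"
proof -
  have "walk_edges (x # y # p) =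
      (\<lambda>i. {(x # y # p) ! i, (y # p) ! i}) ` {..<Suc (length p)}"
    by (auto simp: walk_edges_def)
  also have "\<dots> = insert {x, y} ((\<lambda>i. {(y # p) ! i, p ! i}) ` {..<length p})"
    by (simp only: lessThan_Suc_eq_insert_0 image_insert image_image) simp
  also have "(\<lambda>i. {(y # p) ! i, p ! i}) ` {..<length p} = walk_edges (y # p)"
    by (auto simp: walk_edges_def)
  finally show ?thesis .
qed

lemma walk_imp_rtrancl: "walk V E v p w \<Longrightarrow> v \<in> V \<and> w \<in> V \<and> (v, w) \<in> (adj E)\<^sup>*"
proof (induction p arbitrary: v rule: induct_list012)
  case (3 x y zs)
  then have "walk V E y (y # zs) w" "v = x" "x \<in> V" "(x, y) \<in> adj E"
    by (auto simp: walk_def walk_edges_Cons_Cons adj_def)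
  with "3.IH"(2)[of y] show ?case by (auto intro: converse_rtrancl_into_rtrancl)
qed (auto simp: walk_def)

lemma rtrancl_imp_walk:
  assumes "(v, w) \<in> (adj E)\<^sup>*" "\<Union>E \<subseteq> V" "w \<in> V"
  shows "\<exists>p. walk V E v p w"
  using assms(1)
proof (induction rule: converse_rtrancl_induct)
  case base
  have "walk V E w [w] w" using assms by (simp add: walk_def)
  then show ?case ..
next
  case (step x y)
  then obtain p where p: "walk V E y p w" by blast
  then obtain ps where ps: "p = y # ps" by (cases p) (auto simp: walk_def)
  have "x \<in> V" using step.hyps(1) assms(2) by (auto simp: adj_def)
  then have "walk V E x (x # p) w"
    using p step.hyps(1) by (auto simp: walk_def ps walk_edges_Cons_Cons adj_def)
  then show ?case ..
qed

lemma connected_graph_iff_rtrancl: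
  assumes "\<Union>E \<subseteq> V"
  shows "connected_graph V E \<longleftrightarrow> (\<forall>v\<in>V. \<forall>w\<in>V. (v, w) \<in> (adj E)\<^sup>*)"
  unfolding connected_graph_def
  using walk_imp_rtrancl[of V E] rtrancl_imp_walk[OF _ assms] by meson

text \<open>The walks that avoid \<open>e\<close> are exactly the walks of \<open>E - {e}\<close>,
  so relevance depends only on reachability after the deletion of \<open>e\<close>.\<close>

lemma rel_eq_rtrancl:
  assumes "\<Union>E \<subseteq> V"
  shows "rel V E e v = card {w \<in> V. (v, w) \<notin> (adj (E - {e}))\<^sup>*}"
proof -
  have "\<Union>(E - {e}) \<subseteq> V" using assms by auto
  then have "(\<exists>p. walk V (E - {e}) v p w) \<longleftrightarrow> (v, w) \<in> (adj (E - {e}))\<^sup>*" if "w \<in> V" for w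
    using that walk_imp_rtrancl rtrancl_imp_walk by metis
  moreover have "walk V (E - {e}) v p w \<longleftrightarrow> walk V E v p w \<and> e \<notin> walk_edges p" for p w
    by (auto simp: walk_def)
  ultimately have "(\<forall>p. walk V E v p w \<longrightarrow> e \<in> walk_edges p) \<longleftrightarrow>
      (v, w) \<notin> (adj (E - {e}))\<^sup>*" if "w \<in> V" for w
    using that by blast
  then show ?thesis unfolding rel_def by (intro arg_cong[of _ _ card]) auto
qed

lemma rel_le_card: "finite V \<Longrightarrow> rel V E e v \<le> card V"
  unfolding rel_def by (rule card_mono) auto

section \<open>Spanning forests and the number of components\<close>

text \<open>Taking the image under the larger closure maps the old components onto the new ones.
  This map is not injective, because the components of \<open>u\<close> and \<open>v\<close> are
  different and become one.\<close>

lemma card_classes_decrease: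
  assumes "finite V" "u \<in> V" "v \<in> V" "(u, v) \<notin> (adj F)\<^sup>*"
  shows "card ((\<lambda>x. (adj (insert {u, v} F))\<^sup>* `` {x}) ` V) < card ((\<lambda>x. (adj F)\<^sup>* `` {x}) ` V)"
proof -
  let ?R = "(adj F)\<^sup>*" and ?R' = "(adj (insert {u, v} F))\<^sup>*"
  let ?A = "(\<lambda>x. ?R `` {x}) ` V"
  have sub: "?R \<subseteq> ?R'" by (rule rtrancl_adj_mono) auto
  have img: "?R' `` (?R `` {x}) = ?R' `` {x}" for x
    using sub by (auto intro: rtrancl_trans)
  have uv: "(u, v) \<in> ?R'" "(v, u) \<in> ?R'" by (auto simp: adj_insert)
  then have "?R' `` (?R `` {u}) = ?R' `` (?R `` {v})"
    unfolding img by (auto intro: rtrancl_trans)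
  moreover have "?R `` {u} \<noteq> ?R `` {v}" using assms(4) by auto
  ultimately have "\<not> inj_on (\<lambda>A. ?R' `` A) ?A"
    using assms(2,3) unfolding inj_on_def by blast
  moreover have "finite ?A" using assms(1) by simp
  ultimately have "card ((\<lambda>A. ?R' `` A) ` ?A) < card ?A"
    using card_image_le[of ?A] eq_card_imp_inj_on[of ?A] by (metis le_neq_implies_less)
  then show ?thesis by (simp only: image_image img)
qed

text \<open>Greedy construction: an edge is kept only if it joins two components of the edges kept
  so far, so each kept edge is paid for by the loss of a component. The number of components is
  carried along for the induction; the later use is \<open>card F \<le> card V\<close>.\<close>

lemma ex_spanning_subset:
  assumes "finite V" "finite E" "\<And>e. e \<in> E \<Longrightarrow> \<exists>u\<in>V. \<exists>v\<in>V. e = {u, v}"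
  shows "\<exists>F\<subseteq>E. (adj F)\<^sup>* = (adj E)\<^sup>* \<and> card F + card ((\<lambda>x. (adj F)\<^sup>* `` {x}) ` V) \<le> card V"
  using assms(2,3)
proof (induction E rule: finite_induct)
  case empty
  then show ?case using card_image_le[OF assms(1)] by auto
next
  case (insert e E)
  then obtain F where F: "F \<subseteq> E" "(adj F)\<^sup>* = (adj E)\<^sup>*"
    "card F + card ((\<lambda>x. (adj F)\<^sup>* `` {x}) ` V) \<le> card V" by blast
  obtain u v where uv: "u \<in> V" "v \<in> V" "e = {u, v}" using insert.prems by blast
  show ?case
  proof (cases "(u, v) \<in> (adj F)\<^sup>*")
    case True
    then have "(adj (insert e E))\<^sup>* = (adj F)\<^sup>*"
      using rtrancl_adj_insert_redundant F(2) uv(3) by metis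
    then show ?thesis using F by (intro exI[of _ F]) auto
  next
    case False
    have "finite F" using F(1) insert.hyps(1) finite_subset by blast
    then have "card (insert e F) = Suc (card F)" using F(1) insert.hyps(2) by (subst card_insert_disjoint) auto
    then have "card (insert e F) + card ((\<lambda>x. (adj (insert e F))\<^sup>* `` {x}) ` V) \<le> card V"
      using card_classes_decrease[OF assms(1) uv(1,2) False] F(3) uv(3) by simp
    \<comment> \<open>The closure of a union depends only on the closures of its parts, so
      \<open>F\<close> may replace \<open>E\<close> before the edge is added.\<close>
    moreover have "(adj (insert e F))\<^sup>* = (adj (insert e E))\<^sup>*"
      unfolding uv(3) adj_insert using F(2) by (metis rtrancl_Un_rtrancl)
    ultimately show ?thesis using F(1) by (intro exI[of _ "insert e F"]) auto
  qed
qed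

section \<open>Deleting an edge whose ends stay doubly joined\<close>

text \<open>An edge \<open>f\<close> lies in at most one of the disjoint sets
  \<open>F\<^sub>1\<close> and \<open>F\<^sub>2\<close>, so the other one still joins
  \<open>u\<close> and \<open>v\<close> after \<open>f\<close> is removed. Hence no relevance
  changes, and only the effect on the set of edges of maximal separation has to be examined.\<close>

lemma disconnection_cost_remove:
  assumes fin: "finite V" "finite E" and EV: "\<Union>E \<subseteq> V" and e: "{u, v} \<in> E" "u \<noteq> v"
    and F: "F\<^sub>1 \<subseteq> E - {{u, v}}" "F\<^sub>2 \<subseteq> E - {{u, v}}" "F\<^sub>1 \<inter> F\<^sub>2 = {}"
      "(u, v) \<in> (adj F\<^sub>1)\<^sup>*" "(u, v) \<in> (adj F\<^sub>2)\<^sup>*"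
    and con: "connected_graph V E" and x: "x \<in> V"
  shows "disconnection_cost V (E - {{u, v}}) x = disconnection_cost V E x"
proof -
  let ?e = "{u, v}"
  let ?E = "E - {?e}"
  have EV': "\<Union>?E \<subseteq> V" using EV by auto
  have reach: "(adj (E - {f}))\<^sup>* = (adj (?E - {f}))\<^sup>*" for f
  proof (cases "f = ?e")
    case False
    have "(u, v) \<in> (adj (?E - {f}))\<^sup>*"
    proof (cases "f \<in> F\<^sub>1")
      case True
      then have "F\<^sub>2 \<subseteq> ?E - {f}" using F by auto
      then show ?thesis using rtrancl_adj_mono F(5) by blast
    next
      case False
      then have "F\<^sub>1 \<subseteq> ?E - {f}" using F by auto
      then show ?thesis using rtrancl_adj_mono F(4) by blast
    qed
    then have "(adj (insert ?e (?E - {f})))\<^sup>* = (adj (?E - {f}))\<^sup>*"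
      by (rule rtrancl_adj_insert_redundant)
    moreover have "insert ?e (?E - {f}) = E - {f}" using e False by auto
    ultimately show ?thesis by simp
  qed simp
  have reachE: "(adj ?E)\<^sup>* = (adj E)\<^sup>*"
  proof -
    have "(u, v) \<in> (adj ?E)\<^sup>*" using rtrancl_adj_mono F(1,4) by blast
    from rtrancl_adj_insert_redundant[OF this] e show ?thesis by (simp add: insert_absorb)
  qed
  have rel: "rel V ?E f y = rel V E f y" for f y
    unfolding rel_eq_rtrancl[OF EV] rel_eq_rtrancl[OF EV'] reach ..
  then have sep: "sep V ?E f = sep V E f" for f by (simp add: sep_def)
  have con': "connected_graph V ?E"
    using con unfolding connected_graph_iff_rtrancl[OF EV] connected_graph_iff_rtrancl[OF EV'] reachE .
  have "rel V E ?e y = 0" if "y \<in> V" for y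
  proof -
    have "{w \<in> V. (y, w) \<notin> (adj ?E)\<^sup>*} = {}"
      using con' that unfolding connected_graph_iff_rtrancl[OF EV'] by auto
    then show ?thesis unfolding rel_eq_rtrancl[OF EV] by (simp only: card.empty)
  qed
  then have sep_e: "sep V E ?e = 0" by (simp add: sep_def)
  \<comment> \<open>Some edge must survive, so that the maximum over the remaining edges is taken
    over a nonempty set.\<close>
  have "F\<^sub>1 \<noteq> {}" using F(4) e(2) by (auto simp: adj_def)
  then have ne: "?E \<noteq> {}" using F(1) by auto
  \<comment> \<open>The deleted edge contributes the value 0, which cannot change a maximum of
    natural numbers taken over a nonempty set of further edges.\<close>
  have max_eq: "sep_max V ?E = sep_max V E"
  proof -
    have "sep V E ` E = insert 0 (sep V E ` ?E)" using e(1) sep_e by force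
    then have "sep_max V E = max 0 (Max (sep V E ` ?E))"
      unfolding sep_max_def using fin ne by (simp add: Max_insert)
    then show ?thesis by (simp add: sep_max_def sep)
  qed
  show ?thesis
  \<comment> \<open>If the maximum is 0, the deleted edge is itself a target and
    \<open>E_max\<close> shrinks, but both averages are 0. Otherwise the deleted edge is no target
    and \<open>E_max\<close> stays the same.\<close>
  proof (cases "sep_max V E = 0")
    case True
    have "rel V E f x = 0" if "f \<in> E" for f
    proof -
      have "sep V E f \<le> sep_max V E" unfolding sep_max_def using fin that by (intro Max_ge) auto
      then show ?thesis using True fin x by (simp add: sep_def)
    qed
    then show ?thesis
      using con con' by (simp add: disconnection_cost_def rel E_max_def)
  next
    case False
    then have "E_max V ?E = E_max V E"
      unfolding E_max_def max_eq sep using sep_e by auto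
    then show ?thesis using con con' by (simp add: disconnection_cost_def rel)
  qed
qed

section \<open>Bounds on the disconnection cost, and the effect of withdrawing a request\<close>

lemma disconnection_cost_nonneg: "0 \<le> disconnection_cost V E v"
  by (simp add: disconnection_cost_def sum_nonneg)

lemma disconnection_cost_le_card:
  assumes "finite V" "connected_graph V E"
  shows "disconnection_cost V E v \<le> ereal (real (card V))"
proof -
  have "(\<Sum>e\<in>E_max V E. real (rel V E e v)) \<le> real (card (E_max V E)) * real (card V)"
    using sum_bounded_above[of "E_max V E" "\<lambda>e. real (rel V E e v)"] rel_le_card[OF assms(1)] by simp
  \<comment> \<open>When \<open>card (E_max V E)\<close> is 0, division by zero makes the cost 0;
    otherwise the cost is an average of numbers that are at most \<open>card V\<close>.\<close>
  then show ?thesis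
    using assms(2) by (cases "card (E_max V E) = 0")
      (simp_all add: disconnection_cost_def field_simps)
qed

lemma final_edges_essential:
  assumes "essential n S"
  shows "final_edges n S = {{v, w} | v w. S v w}"
  using assms unfolding final_edges_def essential_def profile_def by blast

lemma edge_in_final_edges_iff:
  assumes "essential n S"
  shows "{v, w} \<in> final_edges n S \<longleftrightarrow> S v w"
  using assms unfolding final_edges_essential[OF assms]
  by (auto simp: doubleton_eq_iff essential_def)

lemma Union_final_edges: "\<Union>(final_edges n S) \<subseteq> {1..n}"
  by (auto simp: final_edges_def)

lemma finite_final_edges: "finite (final_edges n S)"
  by (rule finite_subset[of _ "Pow {1..n}"]) (auto simp: final_edges_def)

text \<open>An edge needs both requests, so it disappears although the reverse entry is left in
  place.\<close>

lemma final_edges_remove: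
  "final_edges n (set_entry S v w False) = final_edges n S - {{v, w}}"
proof -
  have "set_entry S v w False x y \<and> set_entry S v w False y x \<longleftrightarrow>
      S x y \<and> S y x \<and> {x, y} \<noteq> {v, w}" for x y
    by (auto simp: set_entry_def doubleton_eq_iff)
  then show ?thesis unfolding final_edges_def by blast
qed

lemma individual_cost_remove:
  assumes "essential n S" "S v w"
    and "disconnection_cost {1..n} (final_edges n S - {{v, w}}) v =
      disconnection_cost {1..n} (final_edges n S) v"
  shows "individual_cost n \<alpha> S v = ereal \<alpha> + individual_cost n \<alpha> (set_entry S v w False) v"
proof -
  let ?S = "set_entry S v w False"
  have w: "w \<in> {1..n}" using assms(1,2) by (auto simp: essential_def profile_def)
  have "(\<Sum>x\<in>{1..n}. of_bool (S v x)) = 1 + (\<Sum>x\<in>{1..n} - {w}. of_bool (S v x) :: real)"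
    by (subst sum.remove[OF finite_atLeastAtMost w]) (simp only: assms(2) of_bool_eq)
  also have "(\<Sum>x\<in>{1..n} - {w}. of_bool (S v x)) = (\<Sum>x\<in>{1..n} - {w}. of_bool (?S v x) :: real)"
    by (rule sum.cong) (auto simp: set_entry_def)
  also have "\<dots> = (\<Sum>x\<in>{1..n}. of_bool (?S v x))"
    by (rule sum.mono_neutral_left) (auto simp: set_entry_def)
  finally have "\<alpha> * (\<Sum>x\<in>{1..n}. of_bool (S v x)) = \<alpha> + \<alpha> * (\<Sum>x\<in>{1..n}. of_bool (?S v x))"
    by (simp add: distrib_left)
  then show ?thesis
    unfolding individual_cost_def final_edges_remove assms(3)
    by (simp only: plus_ereal.simps(1)[symmetric] add.assoc)
qed

section \<open>Edge count and connectedness of stable profiles\<close>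

lemma pairwise_stable_card_edges:
  assumes ess: "essential n S" and st: "pairwise_stable n \<alpha> S" and \<alpha>: "\<alpha> > 0"
    and con: "connected_graph {1..n} (final_edges n S)"
  shows "card (final_edges n S) \<le> 2 * n"
proof -
  let ?V = "{1..n}" and ?E = "final_edges n S"
  have edge: "\<exists>u\<in>?V. \<exists>v\<in>?V. e = {u, v}" if "e \<in> ?E" for e
    using that unfolding final_edges_def by blast
  obtain F\<^sub>1 where F\<^sub>1: "F\<^sub>1 \<subseteq> ?E" "(adj F\<^sub>1)\<^sup>* = (adj ?E)\<^sup>*" "card F\<^sub>1 \<le> n"
    using ex_spanning_subset[of ?V ?E] edge finite_final_edges by fastforce
  \<comment> \<open>Choosing the second forest among the edges left over by the first makes the two
    disjoint.\<close>
  obtain F\<^sub>2 where F\<^sub>2: "F\<^sub>2 \<subseteq> ?E - F\<^sub>1" "(adj F\<^sub>2)\<^sup>* = (adj (?E - F\<^sub>1))\<^sup>*" "card F\<^sub>2 \<le> n"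
    using ex_spanning_subset[of ?V "?E - F\<^sub>1"] edge finite_final_edges by fastforce
  have "?E \<subseteq> F\<^sub>1 \<union> F\<^sub>2"
  proof
    fix e assume e: "e \<in> ?E"
    show "e \<in> F\<^sub>1 \<union> F\<^sub>2"
    proof (rule ccontr)
      assume out: "e \<notin> F\<^sub>1 \<union> F\<^sub>2"
      obtain u v where uv: "e = {u, v}" "u \<in> ?V" "u \<noteq> v" "S u v"
        using e by (auto simp: final_edges_def)
      \<comment> \<open>The edge belongs to both spanned graphs but to neither forest, so each
        forest joins its ends without using it.\<close>
      have "(u, v) \<in> adj ?E" "(u, v) \<in> adj (?E - F\<^sub>1)" using e out uv by (auto simp: adj_def)
      then have "disconnection_cost ?V (?E - {{u, v}}) u = disconnection_cost ?V ?E u"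
        using disconnection_cost_remove[of ?V ?E u v F\<^sub>1 F\<^sub>2 u] finite_final_edges
          Union_final_edges e out uv con F\<^sub>1 F\<^sub>2 by blast
      \<comment> \<open>Finiteness makes the saving of \<alpha> a strict decrease; \<infinity> would
        absorb it.\<close>
      moreover from this have "\<bar>individual_cost n \<alpha> (set_entry S u v False) u\<bar> \<noteq> \<infinity>"
        using con by (simp add: individual_cost_def final_edges_remove disconnection_cost_def)
      ultimately have "individual_cost n \<alpha> (set_entry S u v False) u < individual_cost n \<alpha> S u"
        using \<alpha> by (subst individual_cost_remove[OF ess uv(4)]) auto
      moreover have "individual_cost n \<alpha> S u \<le> individual_cost n \<alpha> (set_entry S u v False) u"
        using st e uv(1) unfolding pairwise_stable_def by blast
      ultimately show False by (simp add: leD)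
    qed
  qed
  moreover have "finite (F\<^sub>1 \<union> F\<^sub>2)"
    using F\<^sub>1(1) F\<^sub>2(1) by (intro finite_subset[OF _ finite_final_edges[of n S]]) auto
  ultimately have "card ?E \<le> card (F\<^sub>1 \<union> F\<^sub>2)" by (rule card_mono[rotated])
  also have "\<dots> \<le> card F\<^sub>1 + card F\<^sub>2" by (rule card_Un_le)
  finally show ?thesis using F\<^sub>1(3) F\<^sub>2(3) by simp
qed

text \<open>In a disconnected graph every cost is \<infinity>. Adding a missing edge then never
  makes the first player worse off, so stability would require the cost of the second to exceed
  \<infinity>. Hence no edge could be missing, yet an edge between different components is.\<close>

lemma pairwise_stable_connected:
  assumes "no_mutual_addition n \<alpha> S"
  shows "connected_graph {1..n} (final_edges n S)"
proof (rule ccontr)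
  assume dis: "\<not> ?thesis"
  then obtain v w where vw: "v \<in> {1..n}" "w \<in> {1..n}" "(v, w) \<notin> (adj (final_edges n S))\<^sup>*"
    unfolding connected_graph_iff_rtrancl[OF Union_final_edges] by blast
  then have "v \<noteq> w" "{v, w} \<notin> final_edges n S" by (auto simp: adj_def)
  moreover have "individual_cost n \<alpha> S x = \<infinity>" for x
    using dis by (simp add: individual_cost_def disconnection_cost_def)
  moreover from this have "\<forall>v\<in>{1..n}. \<forall>w\<in>{1..n}. v = w \<or> {v, w} \<in> final_edges n S"
    using assms by (simp add: no_mutual_addition_def Let_def)
  ultimately show False using vw(1,2) by blast
qed

section \<open>Social cost of stable and of optimal profiles\<close>

text \<open>The inequality needed from the handshake identity: a request is determined by its edge
  and the bit \<open>v < w\<close>, which tells the two orientations apart.\<close>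

lemma sum_degrees_le:
  assumes "essential n S"
  shows "(\<Sum>v\<in>{1..n}. \<Sum>w\<in>{1..n}. of_bool (S v w)) \<le> 2 * real (card (final_edges n S))"
proof -
  let ?P = "{(v, w). S v w}"
  have P: "?P = ({1..n} \<times> {1..n}) \<inter> {(v, w). S v w}"
    using assms by (auto simp: essential_def profile_def)
  have "(\<Sum>v\<in>{1..n}. \<Sum>w\<in>{1..n}. of_bool (S v w)) =
      (\<Sum>(v, w)\<in>{1..n} \<times> {1..n}. of_bool (S v w) :: real)"
    by (rule sum.cartesian_product)
  also have "\<dots> = (\<Sum>z\<in>{1..n} \<times> {1..n}. if z \<in> ?P then 1 else 0)"
    by (rule sum.cong) auto
  also have "\<dots> = real (card (({1..n} \<times> {1..n}) \<inter> ?P))"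
    by (subst sum.inter_restrict[symmetric]) auto
  also have "\<dots> = real (card ?P)" by (simp only: P[symmetric])
  finally have "(\<Sum>v\<in>{1..n}. \<Sum>w\<in>{1..n}. of_bool (S v w)) = real (card ?P)" .
  moreover have "card ?P \<le> card (final_edges n S \<times> (UNIV :: bool set))"
  proof (rule card_inj_on_le[of "\<lambda>(v, w). ({v, w}, v < w)"])
    show "inj_on (\<lambda>(v, w). ({v, w}, v < w)) ?P"
      by (auto simp: inj_on_def doubleton_eq_iff)
    show "(\<lambda>(v, w). ({v, w}, v < w)) ` ?P \<subseteq> final_edges n S \<times> UNIV"
      using edge_in_final_edges_iff[OF assms] by auto
    show "finite (final_edges n S \<times> (UNIV :: bool set))" by (simp add: finite_final_edges)
  qed
  ultimately show ?thesis by (simp add: card_cartesian_product)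
qed

lemma social_cost_stable_le:
  assumes "essential n S" "pairwise_stable n \<alpha> S" "\<alpha> > 0"
  shows "social_cost n \<alpha> S \<le> ereal (4 * \<alpha> * real n + real n ^ 2)"
proof -
  have con: "connected_graph {1..n} (final_edges n S)"
    using assms(2) pairwise_stable_connected by (auto simp: pairwise_stable_def)
  have "social_cost n \<alpha> S \<le> (\<Sum>v\<in>{1..n}. ereal (\<alpha> * (\<Sum>w\<in>{1..n}. of_bool (S v w)) + real n))"
    unfolding social_cost_def individual_cost_def
    using disconnection_cost_le_card[OF _ con] by (intro sum_mono) (simp add: add_left_mono flip: plus_ereal.simps(1))
  also have "\<dots> = ereal (\<alpha> * (\<Sum>v\<in>{1..n}. \<Sum>w\<in>{1..n}. of_bool (S v w)) + real n ^ 2)"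
    by (simp only: sum_ereal sum.distrib sum_distrib_left[symmetric])
      (simp add: power2_eq_square)
  \<comment> \<open>The factor 4 is two requests per edge times at most \<open>2 * n\<close>
    edges.\<close>
  also have "(\<Sum>v\<in>{1..n}. \<Sum>w\<in>{1..n}. of_bool (S v w)) \<le> 4 * real n"
    using sum_degrees_le[OF assms(1)] pairwise_stable_card_edges[OF assms con] by linarith
  finally show ?thesis using assms(3) by (simp add: mult_left_mono algebra_simps)
qed

text \<open>In a connected graph with at least two vertices every player is the end of some edge and
  pays \<alpha> for it; in a disconnected one the cost is \<infinity>.\<close>

lemma social_cost_ge:
  assumes "essential n S" "n \<ge> 2" "\<alpha> > 0"
  shows "ereal (\<alpha> * real n) \<le> social_cost n \<alpha> S"
proof -
  have "ereal \<alpha> \<le> individual_cost n \<alpha> S v" if v: "v \<in> {1..n}" for v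
  proof (cases "connected_graph {1..n} (final_edges n S)")
    case True
    obtain w where "w \<in> {1..n}" "w \<noteq> v"
      using assms(2) v that[of "if v = 1 then 2 else 1"] by auto
    then have "(v, w) \<in> (adj (final_edges n S))\<^sup>*" "w \<noteq> v"
      using True v unfolding connected_graph_iff_rtrancl[OF Union_final_edges] by auto
    \<comment> \<open>The first step of a path from \<open>v\<close> to another player is an edge at
      \<open>v\<close>.\<close>
    then obtain u where "(v, u) \<in> adj (final_edges n S)" by (auto elim: converse_rtranclE)
    then have u: "S v u" using edge_in_final_edges_iff[OF assms(1)] by (simp add: adj_def)
    then have "u \<in> {1..n}" using assms(1) by (auto simp: essential_def profile_def)
    then have "(1::real) \<le> (\<Sum>w\<in>{1..n}. of_bool (S v w))"
      using member_le_sum[of u "{1..n}" "\<lambda>w. of_bool (S v w) :: real"] u by simp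
    then have "ereal \<alpha> \<le> ereal (\<alpha> * (\<Sum>w\<in>{1..n}. of_bool (S v w)))"
      using assms(3) by simp
    then show ?thesis
      unfolding individual_cost_def using disconnection_cost_nonneg by (rule add_increasing2[rotated])
  qed (simp add: individual_cost_def disconnection_cost_def)
  then have "(\<Sum>v\<in>{1..n}. ereal \<alpha>) \<le> social_cost n \<alpha> S"
    unfolding social_cost_def by (rule sum_mono)
  then show ?thesis by (simp add: mult.commute)
qed

section \<open>The ratio, and the passage from Nash equilibria to stable profiles\<close>

lemma price_of_anarchy_le:
  assumes "essential n S" "pairwise_stable n \<alpha> S" "n \<ge> 2" "\<alpha> > 0"
  shows "social_cost n \<alpha> S / OPT n \<alpha> \<le> ereal (4 * (1 + real n / \<alpha>))"
proof -
  have opt: "ereal (\<alpha> * real n) \<le> OPT n \<alpha>"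
    unfolding OPT_def using finite_essential essential_nonempty assms(3,4)
    by (subst Min_ge_iff) (auto intro: social_cost_ge)
  note cost = social_cost_stable_le[OF assms(1,2,4)]
  have pos: "\<alpha> * real n > 0" using assms(3,4) by simp
  show ?thesis
  proof (cases "OPT n \<alpha>")
    case (real r)
    then have r: "\<alpha> * real n \<le> r" "r > 0" using opt pos by auto
    \<comment> \<open>The right-hand side expands to \<open>4 * \<alpha> * n + 4 * n^2\<close>; the
      edge term dictates the constant 4.\<close>
    have "4 * \<alpha> * real n + real n ^ 2 \<le> 4 * (1 + real n / \<alpha>) * (\<alpha> * real n)"
      using assms(4) by (simp add: field_simps power2_eq_square)
    also have "\<dots> \<le> 4 * (1 + real n / \<alpha>) * r"
      using r assms(4) by (intro mult_left_mono) auto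
    finally have "social_cost n \<alpha> S \<le> ereal r * ereal (4 * (1 + real n / \<alpha>))"
      using cost by (metis ereal_less_eq(3) mult.commute order_trans times_ereal.simps(1))
    then show ?thesis unfolding real using r(2) by (simp add: ereal_divide_le_pos)
  next
    \<comment> \<open>In \<open>ereal\<close> a quotient by \<infinity> is 0, so no profile of
      finite cost has to be exhibited.\<close>
    case PInf
    then show ?thesis using assms(4) by simp
  next
    case MInf
    then show ?thesis using opt by simp
  qed
qed

text \<open>Withdrawing a single request is a special change of one's own row, and the condition on
  added edges is shared by both notions.\<close>

lemma pairwise_nash_imp_stable:
  assumes "essential n S" "pairwise_nash n \<alpha> S"
  shows "pairwise_stable n \<alpha> S"
proof -
  have "individual_cost n \<alpha> S v \<le> individual_cost n \<alpha> (set_entry S v w False) v"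
    if "v \<in> {1..n}" for v w
  proof -
    have "profile n (set_entry S v w False)"
      using assms(1) by (auto simp: essential_def profile_def set_entry_def split: if_splits)
    then show ?thesis using assms(2) that by (auto simp: pairwise_nash_def set_entry_def)
  qed
  moreover have "v \<in> {1..n} \<and> w \<in> {1..n}" if "{v, w} \<in> final_edges n S" for v w
    using that Union_final_edges[of n S] by blast
  ultimately show ?thesis using assms(2) by (auto simp: pairwise_stable_def pairwise_nash_def)
qed

theorem mainTheorem7:
  "\<exists>c::real. c > 0 \<and>
     (\<forall>(n::nat) (\<alpha>::real). n \<ge> 3 \<and> \<alpha> > 0 \<longrightarrow>
        (\<forall>S. essential n S \<and> pairwise_stable n \<alpha> S \<longrightarrow>
           social_cost n \<alpha> S / OPT n \<alpha> \<le> ereal (c * (1 + real n / \<alpha>))) \<and>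
        (\<forall>S. essential n S \<and> pairwise_nash n \<alpha> S \<longrightarrow>
           social_cost n \<alpha> S / OPT n \<alpha> \<le> ereal (c * (1 + real n / \<alpha>))))"
  using price_of_anarchy_le pairwise_nash_imp_stable
  by (intro exI[of _ 4]) auto

end
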